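(* Let $X$ be a non-empty topological space, let $\varPhi\subseteq C^0_b(X,\mathbb{R})$ be a set of admissible filtering functions on $X$, and let $G$ be a subgroup of $\mathrm{Homeo}(X)$ such that $\varphi\circ g\in\varPhi$ for every $\varphi\in\varPhi$ and $g\in G$. Let $n\ge 1$ be an integer, let $F_1,\dots,F_n$ be GENEOs for $(\varPhi,G)$, and let $p\ge 1$ be a real number. Define the operator $M_p(F_1,\dots,F_n):\varPhi\to C^0_b(X,\mathbb{R})$ by $$M_p(F_1,\dots,F_n)(\varphi)(x):=\left(\frac1n\sum_{i=1}^n |F_i(\varphi)(x)|^p\right)^{\frac1p}\qquad(\varphi\in\varPhi,\ x\in X).$$ If $M_p(F_1,\dots,F_n)(\varPhi)\subseteq\varPhi$, then $M_p(F_1,\dots,F_n)$ is a GENEO for $(\varPhi,G)$.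
   Context: $C^0_b(X,\mathbb{R})$ is the space of bounded continuous functions $X\to\mathbb{R}$, endowed with the topology induced by the sup-norm $\|\cdot\|_\infty$. $\mathrm{Homeo}(X)$ is the group of all homeomorphisms from $X$ to itself. The set of admissible filtering functions $\varPhi$ is a topological subspace (i.e. a subset with the induced topology, not assumed to be a linear subspace) of $C^0_b(X,\mathbb{R})$ that is assumed to contain at least all constant functions $c$ with $|c|\le\sup_{\varphi\in\varPhi}\|\varphi\|_\infty$. The group $G$ acts on $\varPhi$ by composition on the right. A $G$-equivariant non-expansive operator (GENEO) for $(\varPhi,G)$ is a function $F:\varPhi\to\varPhi$ (not required to be linear) such that: (1) $F(\varphi\circ g)=F(\varphi)\circ g$ for all $\varphi\in\varPhi$ and $g\in G$; (2) $\|F(\varphi_1)-F(\varphi_2)\|_\infty\le\|\varphi_1-\varphi_2\|_\infty$ for all $\varphi_1,\varphi_2\in\varPhi$. *)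

theory Defs
  imports "HOL-Analysis.Analysis" "HOL-Algebra.Group"
begin

text \<open>
  The space \<open>X\<close> is a type of class \<^class>\<open>topological_space\<close> (types are never empty), and
  \<open>C\<^sup>0\<^sub>b(X,\<real>)\<close> is the library type \<^typ>\<open>'a \<Rightarrow>\<^sub>C real\<close>, whose norm is the sup-norm:
\<close>

lemma bcontfun_norm_eq_Sup: "norm (\<phi> :: 'a::topological_space \<Rightarrow>\<^sub>C real) = (SUP x. \<bar>\<phi> x\<bar>)"
  by (simp add: norm_bcontfun_def dist_bcontfun_def)

definition Homeo :: "('a::topological_space \<Rightarrow> 'a) monoid" where
  "Homeo = \<lparr>carrier = {g. \<exists>h. homeomorphism UNIV UNIV g h}, mult = (\<circ>), one = id\<rparr>"

lemma group_Homeo: "group (Homeo :: ('a::topological_space \<Rightarrow> 'a) monoid)"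
proof (rule groupI)
  fix g :: "'a \<Rightarrow> 'a" assume "g \<in> carrier Homeo"
  then obtain h where h: "homeomorphism UNIV UNIV g h" by (auto simp: Homeo_def)
  then have "homeomorphism UNIV UNIV h g" by (rule homeomorphism_symD)
  moreover have "h \<circ> g = id" using h by (auto simp: homeomorphism_def)
  ultimately show "\<exists>y\<in>carrier Homeo. y \<otimes>\<^bsub>Homeo\<^esub> g = \<one>\<^bsub>Homeo\<^esub>"
    by (auto simp: Homeo_def)
next
  fix f g :: "'a \<Rightarrow> 'a" assume "f \<in> carrier Homeo" "g \<in> carrier Homeo"
  then show "f \<otimes>\<^bsub>Homeo\<^esub> g \<in> carrier Homeo"
    by (auto simp: Homeo_def intro: homeomorphism_compose)
next
  show "\<one>\<^bsub>Homeo\<^esub> \<in> carrier (Homeo :: ('a \<Rightarrow> 'a) monoid)"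
    by (auto simp: Homeo_def homeomorphism_def intro!: exI[of _ id])
qed (auto simp: Homeo_def o_assoc)

text \<open>
  The supremum is taken in the extended reals: \<open>\<Phi>\<close> may be unbounded, and then it has to contain
  all constant functions.
\<close>

definition admissible :: "('a::topological_space \<Rightarrow>\<^sub>C real) set \<Rightarrow> bool" where
  "admissible \<Phi> \<longleftrightarrow>
     (\<forall>c. ereal \<bar>c\<bar> \<le> (SUP \<phi>\<in>\<Phi>. ereal (norm \<phi>)) \<longrightarrow> const_bcontfun c \<in> \<Phi>)"

text \<open>
  Right composition as an operation on \<open>C\<^sup>0\<^sub>b(X,\<real>)\<close>; meaningful when \<open>g\<close> is continuous, as the next
  lemma shows.
\<close>

definition bcomp :: "('a::topological_space \<Rightarrow>\<^sub>C real) \<Rightarrow> ('a \<Rightarrow> 'a) \<Rightarrow> ('a \<Rightarrow>\<^sub>C real)"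
    (infixl "\<circ>\<^sub>C" 65) where
  "\<phi> \<circ>\<^sub>C g = Bcontfun (apply_bcontfun \<phi> \<circ> g)"

lemma apply_bcomp:
  assumes "continuous_on UNIV g"
  shows "apply_bcontfun (\<phi> \<circ>\<^sub>C g) = apply_bcontfun \<phi> \<circ> g"
proof -
  have "continuous_on UNIV (apply_bcontfun \<phi> \<circ> g)"
    using assms by (intro continuous_on_compose) (auto intro: continuous_on_subset)
  moreover have "bounded (range (apply_bcontfun \<phi> \<circ> g))"
    by (rule bounded_subset[OF bounded_apply_bcontfun[of \<phi>]]) auto
  ultimately show ?thesis
    unfolding bcomp_def by (intro Bcontfun_inverse) (auto simp: bcontfun_def)
qed

definition GENEO ::
  "('a::topological_space \<Rightarrow>\<^sub>C real) set \<Rightarrow> ('a \<Rightarrow> 'a) set \<Rightarrow>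
   (('a \<Rightarrow>\<^sub>C real) \<Rightarrow> ('a \<Rightarrow>\<^sub>C real)) \<Rightarrow> bool" where
  "GENEO \<Phi> G F \<longleftrightarrow>
     F \<in> \<Phi> \<rightarrow> \<Phi> \<and>
     (\<forall>\<phi>\<in>\<Phi>. \<forall>g\<in>G. F (\<phi> \<circ>\<^sub>C g) = F \<phi> \<circ>\<^sub>C g) \<and>
     (\<forall>\<phi>\<^sub>1\<in>\<Phi>. \<forall>\<phi>\<^sub>2\<in>\<Phi>. norm (F \<phi>\<^sub>1 - F \<phi>\<^sub>2) \<le> norm (\<phi>\<^sub>1 - \<phi>\<^sub>2))"

text \<open>
  The operators \<open>F\<^sub>1, \<dots>, F\<^sub>n\<close> are the values of \<open>F\<close> on \<open>{1..n}\<close>. The lemma below shows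
  that the pointwise formula does define an element of \<open>C\<^sup>0\<^sub>b(X,\<real>)\<close>.
\<close>

definition power_mean ::
  "real \<Rightarrow> nat \<Rightarrow> (nat \<Rightarrow> ('a::topological_space \<Rightarrow>\<^sub>C real) \<Rightarrow> ('a \<Rightarrow>\<^sub>C real)) \<Rightarrow>
   ('a \<Rightarrow>\<^sub>C real) \<Rightarrow> ('a \<Rightarrow>\<^sub>C real)" where
  "power_mean p n F \<phi> =
     Bcontfun (\<lambda>x. (1 / real n * (\<Sum>i=1..n. \<bar>F i \<phi> x\<bar> powr p)) powr (1 / p))"

lemma apply_power_mean:
  assumes "p \<ge> 1"
  shows "power_mean p n F \<phi> x = (1 / real n * (\<Sum>i=1..n. \<bar>F i \<phi> x\<bar> powr p)) powr (1 / p)"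
proof -
  let ?S = "\<lambda>x. 1 / real n * (\<Sum>i=1..n. \<bar>F i \<phi> x\<bar> powr p)"
  let ?B = "1 / real n * (\<Sum>i=1..n. norm (F i \<phi>) powr p)"
  have S0: "?S x \<ge> 0" for x by (intro mult_nonneg_nonneg sum_nonneg) auto
  have "continuous_on UNIV ?S"
    using assms by (intro continuous_intros continuous_on_powr') auto
  then have "continuous_on UNIV (\<lambda>x. ?S x powr (1 / p))"
    using assms S0 by (intro continuous_on_powr' continuous_intros) auto
  moreover have "?S x powr (1 / p) \<le> ?B powr (1 / p)" for x
  proof (rule powr_mono2)
    have "\<bar>F i \<phi> x\<bar> \<le> norm (F i \<phi>)" for i
      using norm_bounded[of "F i \<phi>" x] by simp
    then show "?S x \<le> ?B"
      using assms by (intro mult_left_mono sum_mono powr_mono2) auto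
  qed (use assms S0 in auto)
  then have "bounded (range (\<lambda>x. ?S x powr (1 / p)))"
    by (auto intro!: boundedI[where B = "?B powr (1 / p)"])
  ultimately show ?thesis
    unfolding power_mean_def by (subst Bcontfun_inverse) (auto simp: bcontfun_def)
qed

end

theory Submission
  imports Defs
begin

text \<open>
  Equivariance is immediate from the pointwise formula. For non-expansiveness, the power mean is
  monotone in the absolute values of its arguments, and it satisfies the special case
  \<open>M (a + d) \<le> M a + d\<close> of Minkowski's inequality for \<open>d\<close> constant. So if
  \<open>F\<^sub>i \<phi>\<^sub>1\<close> and \<open>F\<^sub>i \<phi>\<^sub>2\<close> differ by at most \<open>d\<close> at a point for all \<open>i\<close>, then so do the two means.
\<close>

text \<open>Convexity of \<open>s powr p\<close> between \<open>y\<close> and 1, where the value at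
  1 is 1. Convexity is invoked only for \<open>y > 0\<close>; at \<open>y = 0\<close> the claim
  reduces to \<open>(1 - t) powr p \<le> 1 - t\<close>, because \<open>0 powr p = 0\<close>.\<close>

lemma powr_convex_combination_one:
  fixes p t y :: real
  assumes "p \<ge> 1" "0 \<le> t" "t \<le> 1" "y \<ge> 0"
  shows "(t * y + (1 - t)) powr p \<le> t * y powr p + (1 - t)"
proof (cases "y = 0")
  case True
  have "(1 - t) powr p \<le> (1 - t) powr 1" using assms by (intro powr_mono') auto
  then show ?thesis using True assms by simp
next
  case False
  then show ?thesis
    using convex_onD[OF powr_convex[OF \<open>p \<ge> 1\<close>], of "1 - t" y 1] assms by simp
qed

text \<open>With \<open>M\<close> the power mean of the \<open>a i\<close>, each
  \<open>a i + d\<close> is \<open>M + d\<close> times a convex combination of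
  \<open>a i / M\<close> and 1, with weights that do not depend on \<open>i\<close>. Convexity
  applies termwise, and the mean of the \<open>(a i / M) powr p\<close> is 1.\<close>

lemma power_mean_add_const_le:
  fixes a :: "'i \<Rightarrow> real" and p d :: real
  assumes "finite I" "I \<noteq> {}" "p \<ge> 1" "d \<ge> 0" and a0: "\<And>i. i \<in> I \<Longrightarrow> a i \<ge> 0"
  shows "(1 / real (card I) * (\<Sum>i\<in>I. (a i + d) powr p)) powr (1 / p)
       \<le> (1 / real (card I) * (\<Sum>i\<in>I. a i powr p)) powr (1 / p) + d"
proof -
  define N where "N = real (card I)"
  define S where "S = 1 / N * (\<Sum>i\<in>I. a i powr p)"
  define M where "M = S powr (1 / p)"
  have N: "N > 0" using assms by (simp add: N_def card_gt_0_iff)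
  have S0: "S \<ge> 0" using N by (auto simp: S_def intro!: sum_nonneg divide_nonneg_pos)
  have Mp: "M powr p = S" using S0 \<open>p \<ge> 1\<close> by (simp add: M_def powr_powr)
  have M0: "M \<ge> 0" by (simp add: M_def)
  have "1 / N * (\<Sum>i\<in>I. (a i + d) powr p) \<le> (M + d) powr p"
  \<comment> \<open>Division by \<open>M\<close> is impossible here, but then every
    \<open>a i\<close> vanishes and both sides equal \<open>d powr p\<close>.\<close>
  proof (cases "M = 0")
    case True
    then have "(\<Sum>i\<in>I. a i powr p) = 0" using N by (simp add: M_def S_def)
    then have "\<forall>i\<in>I. a i = 0" using \<open>finite I\<close> by (simp add: sum_nonneg_eq_0_iff)
    then show ?thesis using N True by (simp add: N_def)
  next
    case False
    then have Mpos: "M > 0" using M0 by simp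
    \<comment> \<open>The weights are proportional to \<open>M\<close> and \<open>d\<close>, so
      scaling by \<open>M + d\<close> turns \<open>t\<close> into \<open>M\<close> and
      \<open>1 - t\<close> into \<open>d\<close>.\<close>
    define t where "t = M / (M + d)"
    have t: "0 \<le> t" "t \<le> 1" using Mpos \<open>d \<ge> 0\<close> by (auto simp: t_def)
    have Md: "M + d > 0" using Mpos \<open>d \<ge> 0\<close> by simp
    have term_le: "(a i + d) powr p \<le> (M + d) powr p * (t / S * a i powr p + (1 - t))" if "i \<in> I" for i
    proof -
      have ai: "a i \<ge> 0" using a0 that .
      have t_d: "(M + d) * t = M" "(M + d) * (1 - t) = d" using Md by (auto simp: t_def field_simps)
      have "a i + d = (M + d) * (t * (a i / M) + (1 - t))"
        using Mpos t_d by (simp add: distrib_left mult.assoc[symmetric])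
      then have "(a i + d) powr p = (M + d) powr p * (t * (a i / M) + (1 - t)) powr p"
        using Md t ai Mpos by (simp add: powr_mult)
      moreover have "(t * (a i / M) + (1 - t)) powr p \<le> t * (a i / M) powr p + (1 - t)"
        using powr_convex_combination_one[OF \<open>p \<ge> 1\<close> t, of "a i / M"] ai Mpos by simp
      \<comment> \<open>\<open>M powr p = S\<close> turns \<open>t * (a i / M) powr p\<close> into
        \<open>t / S * a i powr p\<close>.\<close>
      ultimately show ?thesis
        using Mp ai Mpos by (simp add: powr_divide mult_left_mono)
    qed
    have "S > 0" using Mp Mpos by (metis powr_gt_zero less_irrefl)
    have "1 / N * (\<Sum>i\<in>I. (a i + d) powr p)
        \<le> 1 / N * (\<Sum>i\<in>I. (M + d) powr p * (t / S * a i powr p + (1 - t)))"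
      using N term_le by (intro mult_left_mono sum_mono) auto
    also have "\<dots> = (M + d) powr p * (t / S * (1 / N * (\<Sum>i\<in>I. a i powr p)) + (1 - t))"
    proof -
      have "(\<Sum>i\<in>I. t / S * a i powr p + (1 - t)) = t / S * (\<Sum>i\<in>I. a i powr p) + N * (1 - t)"
        by (simp only: sum.distrib sum_distrib_left sum_constant N_def)
      then show ?thesis
        using N by (simp only: sum_distrib_left[symmetric]) (simp add: add_divide_distrib distrib_left)
    qed
    \<comment> \<open>The mean of the \<open>a i powr p\<close> is \<open>S\<close>, so the bracket
      collapses to \<open>t + (1 - t) = 1\<close>.\<close>
    also have "\<dots> = (M + d) powr p * (t / S * S + (1 - t))" by (simp only: S_def)
    also have "\<dots> = (M + d) powr p" using \<open>S > 0\<close> by simp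
    finally show ?thesis .
  qed
  then have "(1 / N * (\<Sum>i\<in>I. (a i + d) powr p)) powr (1 / p) \<le> ((M + d) powr p) powr (1 / p)"
    using N \<open>p \<ge> 1\<close> by (intro powr_mono2) (auto intro!: sum_nonneg divide_nonneg_pos)
  also have "\<dots> = M + d" using M0 \<open>p \<ge> 1\<close> \<open>d \<ge> 0\<close> by (simp add: powr_powr)
  finally show ?thesis by (simp add: M_def S_def N_def)
qed

text \<open>One half of the pointwise estimate; exchanging \<open>\<phi>\<close> and
  \<open>\<psi>\<close> gives the other half.\<close>

lemma power_mean_le_add:
  fixes F :: "nat \<Rightarrow> ('a::topological_space \<Rightarrow>\<^sub>C real) \<Rightarrow> ('a \<Rightarrow>\<^sub>C real)"
  assumes "n \<ge> 1" "p \<ge> 1" "\<And>i. i \<in> {1..n} \<Longrightarrow> norm (F i \<phi> - F i \<psi>) \<le> d"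
  shows "power_mean p n F \<phi> x \<le> power_mean p n F \<psi> x + d"
proof -
  have diff: "\<bar>F i \<phi> x\<bar> \<le> \<bar>F i \<psi> x\<bar> + d" if "i \<in> {1..n}" for i
    using norm_bounded[of "F i \<phi> - F i \<psi>" x] assms(3)[OF that] by simp
  \<comment> \<open>Since \<open>n \<ge> 1\<close>, the index 1 is available and forces
    \<open>d\<close> to be nonnegative.\<close>
  have "0 \<le> norm (F 1 \<phi> - F 1 \<psi>)" by simp
  also have "\<dots> \<le> d" using assms by simp
  finally have d: "d \<ge> 0" .
  have "power_mean p n F \<phi> x \<le> (1 / real n * (\<Sum>i=1..n. (\<bar>F i \<psi> x\<bar> + d) powr p)) powr (1 / p)"
    unfolding apply_power_mean[OF \<open>p \<ge> 1\<close>] using \<open>p \<ge> 1\<close> diff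
    by (intro powr_mono2 mult_left_mono sum_mono mult_nonneg_nonneg sum_nonneg) auto
  also have "\<dots> \<le> power_mean p n F \<psi> x + d"
    unfolding apply_power_mean[OF \<open>p \<ge> 1\<close>]
    using power_mean_add_const_le[of "{1..n}" p d "\<lambda>i. \<bar>F i \<psi> x\<bar>"] assms d by simp
  finally show ?thesis .
qed

theorem theorem2:
  fixes \<Phi> :: "('a::topological_space \<Rightarrow>\<^sub>C real) set"
    and G :: "('a \<Rightarrow> 'a) set"
    and F :: "nat \<Rightarrow> ('a \<Rightarrow>\<^sub>C real) \<Rightarrow> ('a \<Rightarrow>\<^sub>C real)"
    and n :: nat and p :: real
  assumes "admissible \<Phi>"
    and "subgroup G Homeo"
    and "\<And>\<phi> g. \<phi> \<in> \<Phi> \<Longrightarrow> g \<in> G \<Longrightarrow> \<phi> \<circ>\<^sub>C g \<in> \<Phi>"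
    and "n \<ge> 1"
    and "\<And>i. i \<in> {1..n} \<Longrightarrow> GENEO \<Phi> G (F i)"
    and "p \<ge> 1"
    and "power_mean p n F ` \<Phi> \<subseteq> \<Phi>"
  shows "GENEO \<Phi> G (power_mean p n F)"
  unfolding GENEO_def
proof (intro conjI ballI)
  show "power_mean p n F \<in> \<Phi> \<rightarrow> \<Phi>" using assms(7) by auto
next
  fix \<phi> g assume \<phi>: "\<phi> \<in> \<Phi>" and g: "g \<in> G"
  have "g \<in> carrier Homeo" using subgroup.subset[OF assms(2)] g by auto
  \<comment> \<open>Continuity of \<open>g\<close> is what lets \<open>apply_bcomp\<close> evaluate
    \<open>\<circ>\<^sub>C\<close> pointwise.\<close>
  then have cont: "continuous_on UNIV g" by (auto simp: Homeo_def homeomorphism_def)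
  have "F i (\<phi> \<circ>\<^sub>C g) x = F i \<phi> (g x)" if "i \<in> {1..n}" for i x
    using assms(5)[OF that] \<phi> g by (simp add: GENEO_def apply_bcomp[OF cont])
  then show "power_mean p n F (\<phi> \<circ>\<^sub>C g) = power_mean p n F \<phi> \<circ>\<^sub>C g"
    by (intro bcontfun_eqI) (simp add: apply_bcomp[OF cont] apply_power_mean[OF \<open>p \<ge> 1\<close>])
next
  fix \<phi> \<psi> assume "\<phi> \<in> \<Phi>" "\<psi> \<in> \<Phi>"
  then have "norm (F i \<phi> - F i \<psi>) \<le> norm (\<phi> - \<psi>)" if "i \<in> {1..n}" for i
    using assms(5)[OF that] by (simp add: GENEO_def)
  then have "power_mean p n F \<phi> x \<le> power_mean p n F \<psi> x + norm (\<phi> - \<psi>)"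
    and "power_mean p n F \<psi> x \<le> power_mean p n F \<phi> x + norm (\<phi> - \<psi>)" for x
    using assms(4,6) by (auto intro!: power_mean_le_add simp: norm_minus_commute)
  \<comment> \<open>The two one-sided bounds control the absolute difference at every
    \<open>x\<close> by the same constant, hence the sup-norm.\<close>
  then show "norm (power_mean p n F \<phi> - power_mean p n F \<psi>) \<le> norm (\<phi> - \<psi>)"
    by (intro norm_bound) (simp add: abs_le_iff algebra_simps)
qed

end
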